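(* Let $\alpha\in(0,\infty)\setminus\{1\}$. Let $u:\mathbb{Q}\cap[0,1]\to\mathbb{R}$ be a function such that $$u(1-x)+(1-x)^\alpha\, u\!\left(\frac{y}{1-x}\right) = u(y) + (1-y)^\alpha\, u\!\left(\frac{1-x-y}{1-y}\right)$$ for all rational $x,y\in[0,1)$ with $x+y\in[0,1]$. Then $u$ is a multiple of $s_\alpha$, i.e. there exists $\lambda\in\mathbb{R}$ such that $u(x)=\lambda s_\alpha(x)$ for all $x\in\mathbb{Q}\cap[0,1]$, where $$s_\alpha(x)=\frac{1}{1-\alpha}\left(x^\alpha+(1-x)^\alpha-1\right).$$
   Context: Since $\alpha>0$, $0^\alpha=0$. *)

theory Defs
  imports Complex_Main
begin

text \<open>The convention \<open>0\<^sup>\<alpha> = 0\<close> for \<open>\<alpha> > 0\<close> is built into \<^const>\<open>powr\<close>.\<close>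

definition s_entropy :: "real \<Rightarrow> real \<Rightarrow> real" where
  "s_entropy \<alpha> x = 1 / (1 - \<alpha>) * (x powr \<alpha> + (1 - x) powr \<alpha> - 1)"

end

theory Submission
  imports Defs
begin

text \<open>Put \<open>F(m, n) = (m + n)\<^sup>\<alpha> u(m / (m + n))\<close> for natural numbers \<open>m, n\<close>. The functional equation says
  that \<open>F\<close> is a 2-cocycle on the additive monoid of natural numbers, so
  \<open>F(m, n) = f(m) + f(n) - f(m + n)\<close> with \<open>f(1) = 0\<close>. As \<open>F\<close> is homogeneous of degree \<open>\<alpha>\<close>,
  \<open>n \<mapsto> f(k n) - k\<^sup>\<alpha> f(n)\<close> is additive, i.e. \<open>f(k n) = k\<^sup>\<alpha> f(n) + n f(k)\<close>. Exchanging \<open>k\<close> and \<open>n\<close>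
  gives \<open>f(n) (k\<^sup>\<alpha> - k) = f(k) (n\<^sup>\<alpha> - n)\<close>, and \<open>k = 2\<close> determines \<open>f\<close> up to a scalar since \<open>\<alpha> \<noteq> 1\<close>.\<close>

text \<open>The case \<open>n = 1\<close> with \<open>f 1 = 0\<close> forces
  \<open>f (Suc m) = f m - F m 1\<close>, which fixes \<open>f\<close> as a sum. The cocycle
  identity with last argument 1 then carries the formula from \<open>n\<close> to
  \<open>Suc n\<close>.\<close>

lemma nat_cocycle_coboundary:
  fixes F :: "nat \<Rightarrow> nat \<Rightarrow> real"
  assumes cocycle: "\<And>m n k. n > 0 \<Longrightarrow> F m n + F (m + n) k = F n k + F m (n + k)"
    and right: "\<And>m. F m 0 = 0" and left: "\<And>n. F 0 n = 0"
  shows "\<exists>f. f 0 = 0 \<and> f 1 = 0 \<and> (\<forall>m n. F m n = f m + f n - f (m + n))"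
proof -
  define f where "f n = - (\<Sum>k<n. F k 1)" for n
  have f_Suc: "f (Suc n) = f n - F n 1" for n
    by (simp add: f_def)
  have f0: "f 0 = 0" and f1: "f 1 = 0"
    using left[of 1] by (simp_all add: f_def)
  have "F m n = f m + f n - f (m + n)" for m n
  proof (induction n)
    case 0
    then show ?case using right f0 by simp
  next
    case (Suc n)
    show ?case
    proof (cases "n = 0")
      case True
      then show ?thesis using f_Suc[of m] f1 by simp
    next
      case False
      then show ?thesis
        using cocycle[of n m 1] Suc.IH f_Suc[of n] f_Suc[of "m + n"] by simp
    qed
  qed
  with f0 f1 show ?thesis by blast
qed

lemma homogeneous_nat_coboundary:
  fixes f :: "nat \<Rightarrow> real" and \<alpha> :: real
  assumes "\<alpha> \<noteq> 1" and f0: "f 0 = 0" and f1: "f 1 = 0"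
    and hom: "\<And>k m n. k > 0 \<Longrightarrow>
      f (k * m) + f (k * n) - f (k * m + k * n) = real k powr \<alpha> * (f m + f n - f (m + n))"
  shows "\<exists>c. \<forall>n. f n = c * (real n powr \<alpha> - real n)"
proof -
  \<comment> \<open>By \<open>hom\<close> with second argument 1 and \<open>f 1 = 0\<close>, the
    difference \<open>f (k * n) - k powr \<alpha> * f n\<close> grows by \<open>f k\<close> whenever
    \<open>n\<close> grows by 1.\<close>
  have mult: "f (k * n) = real k powr \<alpha> * f n + real n * f k" if "k > 0" for k n
  proof (induction n)
    case 0
    then show ?case by (simp add: f0)
  next
    case (Suc n)
    then show ?case
      using hom[OF that, of n 1] f1 by (simp add: algebra_simps)
  qed
  have "(2::real) powr \<alpha> \<noteq> 2 powr 1"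
    using \<open>\<alpha> \<noteq> 1\<close> by (subst powr_inj) auto
  then have ne: "(2::real) powr \<alpha> - 2 \<noteq> 0" by simp
  have "f n = f 2 / (2 powr \<alpha> - 2) * (real n powr \<alpha> - real n)" for n
  proof (cases "n = 0")
    case True
    then show ?thesis by (simp add: f0)
  next
    case False
    then have "2 powr \<alpha> * f n + real n * f 2 = real n powr \<alpha> * f 2 + 2 * f n"
      using mult[of 2 n] mult[of n 2] by (simp add: mult.commute)
    then show ?thesis using ne by (simp add: field_simps)
  qed
  then show ?thesis by blast
qed

theorem corollary1p4:
  fixes \<alpha> :: real and u :: "rat \<Rightarrow> real"
  assumes "\<alpha> > 0" and "\<alpha> \<noteq> 1"
    and "\<And>x y :: rat. x \<in> {0..<1} \<Longrightarrow> y \<in> {0..<1} \<Longrightarrow> x + y \<in> {0..1} \<Longrightarrow>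
      u (1 - x) + of_rat (1 - x) powr \<alpha> * u (y / (1 - x))
        = u y + of_rat (1 - y) powr \<alpha> * u ((1 - x - y) / (1 - y))"
  shows "\<exists>c::real. \<forall>x\<in>{0..1}. u x = c * s_entropy \<alpha> (of_rat x)"
proof -
  have half: "(1/2 :: real) powr \<alpha> \<noteq> 1"
    using powr_less_mono'[of "1/2" 0 \<alpha>] \<open>\<alpha> > 0\<close> by simp
  \<comment> \<open>The terms in \<open>u (1/2)\<close> cancel, leaving
    \<open>u 0 = (1/2) powr \<alpha> * u 0\<close>; likewise for \<open>u 1\<close> below.\<close>
  have u0: "u 0 = 0"
    using assms(3)[of "1/2" 0] half by (simp add: of_rat_divide)
  have u1: "u 1 = 0"
    using assms(3)[of 0 "1/2"] half by (simp add: of_rat_divide)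
  define F where "F m n = real (m + n) powr \<alpha> * u (of_nat m / of_nat (m + n))" for m n :: nat
  have cocycle: "F m n + F (m + n) k = F n k + F m (n + k)" if n: "n > 0" for m n k
  proof -
    \<comment> \<open>The unit interval is split into shares \<open>k/s\<close>, \<open>m/s\<close>,
      \<open>n/s\<close>, and the functional equation is multiplied by
      \<open>s powr \<alpha>\<close>. As \<open>n > 0\<close>, the shares \<open>x\<close> and
      \<open>y\<close> stay below 1.\<close>
    define s where "s = m + n + k"
    define x y :: rat where "x = of_nat k / of_nat s" and "y = of_nat m / of_nat s"
    have s: "s > 0" using n by (simp add: s_def)
    have x: "1 - x = of_nat (m + n) / of_nat s" and y: "1 - y = of_nat (n + k) / of_nat s"
      and xy: "1 - x - y = of_nat n / of_nat s"
    proof -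
      have "1 = (of_nat m + of_nat n + of_nat k) / (of_nat s :: rat)"
        using s by (simp add: s_def flip: of_nat_add)
      then show "1 - x = of_nat (m + n) / of_nat s" "1 - y = of_nat (n + k) / of_nat s"
        "1 - x - y = of_nat n / of_nat s"
        by (simp_all add: x_def y_def add_divide_distrib)
    qed
    have in_dom: "x \<in> {0..<1}" "y \<in> {0..<1}" "x + y \<in> {0..1}"
    proof -
      have "0 \<le> x" "0 \<le> y" by (simp_all add: x_def y_def)
      moreover have "0 < 1 - x" "0 < 1 - y" "0 < 1 - x - y"
        unfolding xy unfolding x y using s n by simp_all
      ultimately show "x \<in> {0..<1}" "y \<in> {0..<1}" "x + y \<in> {0..1}" by auto
    qed
    have scale: "real s powr \<alpha> * of_rat (of_nat j / of_nat s) powr \<alpha> = real j powr \<alpha>" for j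
      using s by (simp add: of_rat_divide powr_divide)
    have args: "y / (1 - x) = of_nat m / of_nat (m + n)"
      "(1 - x - y) / (1 - y) = of_nat n / of_nat (n + k)"
      unfolding xy unfolding x y using s by (simp_all add: y_def)
    have "F (m + n) k + F m n
        = real s powr \<alpha> * (u (1 - x) + of_rat (1 - x) powr \<alpha> * u (y / (1 - x)))"
      unfolding args unfolding x distrib_left mult.assoc[symmetric] scale by (simp add: F_def s_def)
    also have "\<dots> = real s powr \<alpha> * (u y + of_rat (1 - y) powr \<alpha> * u ((1 - x - y) / (1 - y)))"
      using assms(3)[OF in_dom] by simp
    also have "\<dots> = F m (n + k) + F n k"
      unfolding args unfolding y distrib_left mult.assoc[symmetric] scale
      by (simp add: F_def y_def s_def add.assoc)
    finally show ?thesis by simp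
  qed
  \<comment> \<open>At \<open>m = 0\<close> the weight \<open>0 powr \<alpha>\<close> vanishes,
    whatever the value of \<open>u\<close> at \<open>0/0\<close>.\<close>
  have "F m 0 = 0" "F 0 m = 0" for m
    using u0 u1 by (cases "m = 0"; simp add: F_def)+
  with cocycle obtain f where f0: "f 0 = 0" and f1: "f 1 = 0"
    and F: "\<And>m n. F m n = f m + f n - f (m + n)"
    using nat_cocycle_coboundary[of F] by blast
  have "F (k * m) (k * n) = real k powr \<alpha> * F m n" if "k > 0" for k m n
  proof -
    have "real (k * m + k * n) = real k * real (m + n)"
      and "(of_nat (k * m) / of_nat (k * m + k * n) :: rat) = of_nat m / of_nat (m + n)"
      using that by (simp_all flip: distrib_left)
    then show ?thesis by (simp add: F_def powr_mult del: of_nat_add of_nat_mult)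
  qed
  then obtain c where c: "\<And>n. f n = c * (real n powr \<alpha> - real n)"
    using homogeneous_nat_coboundary[OF \<open>\<alpha> \<noteq> 1\<close> f0 f1] by (auto simp: F)
  have "u x = c * (1 - \<alpha>) * s_entropy \<alpha> (of_rat x)" if x: "x \<in> {0..1}" for x
  proof -
    obtain a b where ab: "quotient_of x = (a, b)" by fastforce
    then have b: "b > 0" and x_eq: "x = of_int a / of_int b"
      using quotient_of_denom_pos quotient_of_div by blast+
    with x have "0 \<le> a" "a \<le> b"
      by (simp_all add: zero_le_divide_iff divide_le_eq)
    define m n where "m = nat a" and "n = nat (b - a)"
    have xm: "x = of_nat m / of_nat (m + n)" and mn: "m + n > 0"
      using b \<open>0 \<le> a\<close> \<open>a \<le> b\<close> by (auto simp: x_eq m_def n_def)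
    define t where "t = real (m + n)"
    have t: "t > 0" using mn by (simp add: t_def del: of_nat_add)
    have p: "of_rat x = real m / t" and q: "1 - of_rat x = real n / t"
      using t by (simp_all add: xm of_rat_divide of_rat_add t_def field_simps)
    \<comment> \<open>The linear parts of \<open>f m\<close>, \<open>f n\<close> and
      \<open>f (m + n)\<close> cancel, so only the powers remain.\<close>
    have "t powr \<alpha> * u x = c * (real m powr \<alpha> + real n powr \<alpha> - t powr \<alpha>)"
      using F[of m n] by (simp add: F_def c xm t_def algebra_simps)
    then have "u x = c * ((real m / t) powr \<alpha> + (real n / t) powr \<alpha> - 1)"
      using t by (simp add: powr_divide field_simps)
    then show ?thesis
      using \<open>\<alpha> \<noteq> 1\<close> unfolding s_entropy_def q unfolding p by simp
  qed
  then show ?thesis by blast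
qed

end
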